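(* For every real number $r\in(0,1)$, $$\frac{\pi\sqrt{32-r^4-32r^2}}{8\sqrt2\,\sqrt[4]{(1-r^2)^3}}\le \kappa(r)\le \frac{\pi\sqrt{r^4-32r^2+32}}{8\sqrt2\,\sqrt[4]{(1-r^2)^3}}.$$
   Context: For $0<r<1$, $\kappa(r)$ denotes Legendre's complete elliptic integral of the first kind (with modulus $r$): $$\kappa(r)=\int_0^{\pi/2}\frac{1}{\sqrt{1-r^2\sin^2 t}}\,dt.$$ *)

theory Defs
  imports "HOL-Analysis.Analysis"
begin

text \<open>
  Legendre's complete elliptic integral of the first kind, as a function of the modulus
  \<open>r\<close> (not of the parameter \<open>m = r\<^sup>2\<close>).  For \<open>0 < r < 1\<close> the integrand is continuous on the
  closed interval, so the Henstock--Kurzweil integral is the ordinary Riemann integral.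
\<close>

definition ellipK :: "real \<Rightarrow> real" where
  "ellipK r = integral {0..pi / 2} (\<lambda>t. 1 / sqrt (1 - r\<^sup>2 * (sin t)\<^sup>2))"

text \<open>
  In the lower bound for \<open>ellipK r\<close>, the radicand \<open>32 - r^4 - 32 * r\<^sup>2\<close> is negative for \<open>r\<close> close to
  1 (namely \<open>r\<^sup>2 > 12 * sqrt 2 - 16\<close>), where the classical expression is not real.  Since
  \<open>sqrt (-x) = - sqrt x\<close>, the bound is then a negative number and holds trivially.
\<close>

end

theory Submission
  imports Defs
begin

text \<open>
  Put \<open>s = sqrt (1 - r\<^sup>2)\<close> and \<open>D = cos\<^sup>2 t + s sin\<^sup>2 t\<close>.  Then
  \<open>1 - r\<^sup>2 sin\<^sup>2 t = D\<^sup>2 (1 + x)\<close> with \<open>x = (1 - s)\<^sup>2 sin\<^sup>2 t cos\<^sup>2 t / D\<^sup>2\<close>, so that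
  \<open>1 - x / 2 \<le> (1 + x) powr (-1/2) \<le> 1\<close> encloses the integrand between rational functions of
  \<open>sin t\<close> and \<open>cos t\<close>.  Under \<open>tan \<psi> = a * tan t\<close> with \<open>a = sqrt s\<close> we have \<open>d\<psi> = a * dt / D\<close> and
  \<open>x = (1 - s)\<^sup>2 / (4 s) * sin\<^sup>2 (2 \<psi>)\<close>, so both integrals are elementary, and
  \<open>1 - (1 - s)\<^sup>2 / (16 s) \<le> ellipK r * 2 * sqrt s / pi \<le> 1\<close>.  The two radicands of the theorem are,
  up to normalisation, \<open>1 - \<delta>\<close> and \<open>1 + \<delta>\<close> with \<open>\<delta> = (1 - s\<^sup>2)\<^sup>2 / (32 s\<^sup>2) \<ge> (1 - s)\<^sup>2 / (8 s)\<close>, and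
  \<open>sqrt (1 - \<delta>) \<le> 1 - \<delta> / 2\<close>.
\<close>

lemma cos2_plus_sin2_pos:
  fixes a t :: real
  assumes "a > 0"
  shows "(cos t)\<^sup>2 + a * (sin t)\<^sup>2 > 0"
proof (cases "sin t = 0")
  case True
  then show ?thesis using sin_cos_squared_add[of t] by simp
next
  case False
  then show ?thesis using assms by (intro add_nonneg_pos mult_pos_pos) simp_all
qed

text \<open>The smooth form of \<open>arctan (a * tan t)\<close>, which has no singularity at \<open>pi / 2\<close>.\<close>

definition stretched_angle :: "real \<Rightarrow> real \<Rightarrow> real" where
  "stretched_angle a t = t - arctan ((1 - a) * (sin t * cos t) / ((cos t)\<^sup>2 + a * (sin t)\<^sup>2))"

text \<open>The subtracted \<open>arctan\<close> is \<open>t - \<psi>\<close>, by the subtraction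
  formula for \<open>tan\<close>.\<close>

lemma has_real_derivative_stretched_angle:
  assumes "a > 0"
  shows "(stretched_angle a has_real_derivative a / ((cos t)\<^sup>2 + a\<^sup>2 * (sin t)\<^sup>2)) (at t within S)"
proof -
  define c where "c = cos t"
  define u where "u = sin t"
  define M where "M = c\<^sup>2 + a * u\<^sup>2"
  define N where "N = (1 - a) * (u * c)"
  define D where "D = c\<^sup>2 + a\<^sup>2 * u\<^sup>2"
  have cu: "c\<^sup>2 = 1 - u\<^sup>2" by (simp add: c_def u_def cos_squared_eq)
  have M: "M > 0" using cos2_plus_sin2_pos[OF assms] by (simp add: M_def c_def u_def)
  have D: "D > 0" using cos2_plus_sin2_pos[of "a\<^sup>2"] assms by (simp add: D_def c_def u_def)
  \<comment> \<open>\<open>M\<close> and \<open>N\<close> are \<open>sqrt D\<close> times the cosine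
    and sine of \<open>t - \<psi>\<close>.\<close>
  have MN: "M\<^sup>2 + N\<^sup>2 = D" using cu unfolding M_def N_def D_def by algebra
  \<comment> \<open>Quotient rule: \<open>P\<close> is the numerator of the derivative of
    \<open>N / M\<close>.\<close>
  define P where "P = (1 - a) * (c\<^sup>2 - u\<^sup>2) * M - N * (2 * (a - 1) * u * c)"
  define E where "E = P / M\<^sup>2"
  have deriv: "(stretched_angle a has_real_derivative 1 - E / (1 + (N / M)\<^sup>2)) (at t within S)"
    unfolding stretched_angle_def E_def P_def
    apply (rule derivative_eq_intros refl | use M in \<open>simp add: M_def c_def u_def; fail\<close>)+
    using M
    by (simp add: M_def N_def c_def u_def power2_eq_square) (simp add: field_simps)
  have "1 + (N / M)\<^sup>2 = D / M\<^sup>2"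
    using M MN by (simp add: field_simps)
  moreover have "a = D - P"
    using cu unfolding P_def M_def N_def D_def by algebra
  ultimately have "1 - E / (1 + (N / M)\<^sup>2) = a / D"
    using M D by (simp add: E_def diff_divide_distrib)
  with deriv show ?thesis
    by (simp add: D_def c_def u_def)
qed

lemma stretched_angle_0 [simp]: "stretched_angle a 0 = 0"
  and stretched_angle_pi_half [simp]: "stretched_angle a (pi / 2) = pi / 2"
  by (simp_all add: stretched_angle_def)

lemma has_integral_recip_cos2_plus_sin2:
  assumes "a > 0"
  shows "((\<lambda>t. 1 / ((cos t)\<^sup>2 + a\<^sup>2 * (sin t)\<^sup>2)) has_integral pi / (2 * a)) {0..pi / 2}"
proof -
  have "((\<lambda>t. stretched_angle a t / a) has_vector_derivative 1 / ((cos t)\<^sup>2 + a\<^sup>2 * (sin t)\<^sup>2))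
          (at t within {0..pi / 2})" for t
    unfolding has_real_derivative_iff_has_vector_derivative[symmetric]
    using assms by (auto intro!: derivative_eq_intros has_real_derivative_stretched_angle)
  then have "((\<lambda>t. 1 / ((cos t)\<^sup>2 + a\<^sup>2 * (sin t)\<^sup>2)) has_integral
      stretched_angle a (pi / 2) / a - stretched_angle a 0 / a) {0..pi / 2}"
    by (intro fundamental_theorem_of_calculus) simp_all
  then show ?thesis
    by simp
qed

text \<open>In the variable \<open>\<psi>\<close> the integrand becomes
  \<open>(sin (2 * \<psi>))\<^sup>2 / (4 * a ^ 3)\<close>, whose mean over a quarter turn is
  \<open>1 / (8 * a ^ 3)\<close>.\<close>

lemma has_integral_sin2_cos2_over_cube:
  assumes "a > 0"
  shows "((\<lambda>t. (sin t)\<^sup>2 * (cos t)\<^sup>2 / ((cos t)\<^sup>2 + a\<^sup>2 * (sin t)\<^sup>2) ^ 3) has_integral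
           pi / (16 * a ^ 3)) {0..pi / 2}"
proof -
  \<comment> \<open>The second summand is \<open>- sin (4 * \<psi>) / (32 * a ^ 3)\<close>, written in \<open>t\<close>.\<close>
  define F where "F t = stretched_angle a t / (8 * a ^ 3)
    - sin t * cos t * ((cos t)\<^sup>2 - a\<^sup>2 * (sin t)\<^sup>2) / (8 * a\<^sup>2 * ((cos t)\<^sup>2 + a\<^sup>2 * (sin t)\<^sup>2)\<^sup>2)" for t
  have "(F has_vector_derivative (sin t)\<^sup>2 * (cos t)\<^sup>2 / ((cos t)\<^sup>2 + a\<^sup>2 * (sin t)\<^sup>2) ^ 3)
          (at t within {0..pi / 2})" for t
  proof -
    define c where "c = cos t"
    define u where "u = sin t"
    define D where "D = c\<^sup>2 + a\<^sup>2 * u\<^sup>2"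
    have cu: "c\<^sup>2 = 1 - u\<^sup>2" by (simp add: c_def u_def cos_squared_eq)
    have D: "D > 0" using cos2_plus_sin2_pos[of "a\<^sup>2"] assms by (simp add: D_def c_def u_def)
    \<comment> \<open>\<open>G'\<close> and \<open>D'\<close> are the derivatives of
      \<open>u * c * (c\<^sup>2 - a\<^sup>2 * u\<^sup>2)\<close> and of \<open>D\<close> in
      \<open>t\<close>.\<close>
    define G' where "G' = (c\<^sup>2 - u\<^sup>2) * (c\<^sup>2 - a\<^sup>2 * u\<^sup>2) - u * c * (2 * (1 + a\<^sup>2) * u * c)"
    define D' where "D' = 2 * (a\<^sup>2 - 1) * u * c"
    have "(F has_real_derivative (a / D) / (8 * a ^ 3)
        - (G' * D\<^sup>2 - u * c * (c\<^sup>2 - a\<^sup>2 * u\<^sup>2) * (2 * D * D')) / (8 * a\<^sup>2 * D ^ 4)) (at t within {0..pi/2})"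
      unfolding F_def
      apply (rule derivative_eq_intros has_real_derivative_stretched_angle refl assms
             | use assms D in \<open>simp add: D_def c_def u_def; fail\<close>)+
      unfolding G'_def D'_def c_def[symmetric] u_def[symmetric] D_def[symmetric]
      using D assms
      apply (simp add: D_def[symmetric])
      apply (simp add: divide_simps)
      apply (simp add: D_def)
      apply algebra
      done
    \<comment> \<open>The required equality of derivatives, multiplied by
      \<open>8 * a\<^sup>2 * D ^ 3\<close>.\<close>
    moreover have "D\<^sup>2 - (G' * D - 2 * u * c * (c\<^sup>2 - a\<^sup>2 * u\<^sup>2) * D') = 8 * a\<^sup>2 * u\<^sup>2 * c\<^sup>2"
      using cu unfolding G'_def D'_def D_def by algebra
    then have "(a / D) / (8 * a ^ 3) - (G' * D\<^sup>2 - u * c * (c\<^sup>2 - a\<^sup>2 * u\<^sup>2) * (2 * D * D')) / (8 * a\<^sup>2 * D ^ 4)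
        = u\<^sup>2 * c\<^sup>2 / D ^ 3"
      using D assms
      apply (simp add: divide_simps)
      apply algebra
      done
    ultimately show ?thesis
      unfolding has_real_derivative_iff_has_vector_derivative[symmetric]
      by (simp add: D_def c_def u_def)
  qed
  then have "((\<lambda>t. (sin t)\<^sup>2 * (cos t)\<^sup>2 / ((cos t)\<^sup>2 + a\<^sup>2 * (sin t)\<^sup>2) ^ 3) has_integral
      F (pi / 2) - F 0) {0..pi / 2}"
    by (intro fundamental_theorem_of_calculus) simp_all
  then show ?thesis
    by (simp add: F_def)
qed

text \<open>The lower bound is the tangent at \<open>y = 0\<close> of a function convex in
  \<open>y\<close>.\<close>

lemma inverse_sqrt_enclosure:
  fixes D y :: real
  assumes "D > 0" and "y \<ge> 0"
  shows "1 / D - y / (2 * D ^ 3) \<le> 1 / sqrt (D\<^sup>2 + y)" and "1 / sqrt (D\<^sup>2 + y) \<le> 1 / D"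
proof -
  define w where "w = sqrt (D\<^sup>2 + y)"
  have w2: "w\<^sup>2 = D\<^sup>2 + y" using assms by (simp add: w_def)
  have Dw: "D \<le> w" unfolding w_def using assms by (intro real_le_rsqrt) simp
  then show "1 / sqrt (D\<^sup>2 + y) \<le> 1 / D" using assms by (simp add: w_def[symmetric] frac_le)
  \<comment> \<open>Multiplying the lower bound by \<open>2 * D ^ 3 * w\<close> and putting
    \<open>y = w\<^sup>2 - D\<^sup>2\<close> leaves a cubic with double root
    \<open>w = D\<close>.\<close>
  have "0 \<le> (w - D)\<^sup>2 * (w + 2 * D)" using Dw assms by simp
  also have "\<dots> = 2 * D ^ 3 - w * (2 * D\<^sup>2 - y)" using w2 by algebra
  finally show "1 / D - y / (2 * D ^ 3) \<le> 1 / sqrt (D\<^sup>2 + y)"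
    unfolding w_def[symmetric] using Dw assms
    by (simp add: field_simps power2_eq_square power3_eq_cube)
qed

text \<open>Here \<open>a\<^sup>2\<close> is the \<open>s\<close> of the overview. Nonnegativity
  serves the case of a negative lower radicand.\<close>

lemma ellipK_enclosure:
  assumes "a > 0" and a4: "a ^ 4 = 1 - r\<^sup>2"
  shows "pi / (2 * a) * (1 - (1 - a\<^sup>2)\<^sup>2 / (16 * a\<^sup>2)) \<le> ellipK r" and "ellipK r \<le> pi / (2 * a)"
    and "0 \<le> ellipK r"
proof -
  define D where "D t = (cos t)\<^sup>2 + a\<^sup>2 * (sin t)\<^sup>2" for t
  define y where "y t = (1 - a\<^sup>2)\<^sup>2 * ((sin t)\<^sup>2 * (cos t)\<^sup>2)" for t
  have D: "D t > 0" for t using cos2_plus_sin2_pos[of "a\<^sup>2"] assms by (simp add: D_def)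
  have y: "y t \<ge> 0" for t by (simp add: y_def)
  \<comment> \<open>The right side factors as \<open>((cos t)\<^sup>2 + a ^ 4 * (sin t)\<^sup>2) *
    ((cos t)\<^sup>2 + (sin t)\<^sup>2)\<close>.\<close>
  have eq: "1 - r\<^sup>2 * (sin t)\<^sup>2 = (D t)\<^sup>2 + y t" for t
    using a4 sin_cos_squared_add[of t] unfolding D_def y_def by algebra
  have pos: "(D t)\<^sup>2 + y t > 0" for t using D[of t] y[of t] by (simp add: add_pos_nonneg)
  have K: "((\<lambda>t. 1 / sqrt ((D t)\<^sup>2 + y t)) has_integral ellipK r) {0..pi / 2}"
    unfolding ellipK_def eq
  proof (rule integrable_integral, rule integrable_continuous_interval)
    show "continuous_on {0..pi / 2} (\<lambda>t. 1 / sqrt ((D t)\<^sup>2 + y t))"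
      using pos unfolding D_def y_def
      by (intro continuous_intros) (auto simp: less_imp_neq[symmetric])
  qed
  show "0 \<le> ellipK r"
    by (rule has_integral_nonneg[OF K]) (use pos in \<open>simp add: less_imp_le\<close>)
  have upper: "((\<lambda>t. 1 / D t) has_integral pi / (2 * a)) {0..pi / 2}"
    unfolding D_def by (rule has_integral_recip_cos2_plus_sin2) fact
  show "ellipK r \<le> pi / (2 * a)"
    by (rule has_integral_le[OF K upper]) (rule inverse_sqrt_enclosure D y)+
  have "((\<lambda>t. 1 / D t - (1 - a\<^sup>2)\<^sup>2 / 2 * ((sin t)\<^sup>2 * (cos t)\<^sup>2 / D t ^ 3)) has_integral
          pi / (2 * a) - (1 - a\<^sup>2)\<^sup>2 / 2 * (pi / (16 * a ^ 3))) {0..pi / 2}"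
    using has_integral_sin2_cos2_over_cube[OF \<open>a > 0\<close>]
    by (intro has_integral_diff upper has_integral_mult_right) (simp add: D_def)
  moreover have "1 / D t - (1 - a\<^sup>2)\<^sup>2 / 2 * ((sin t)\<^sup>2 * (cos t)\<^sup>2 / D t ^ 3) \<le> 1 / sqrt ((D t)\<^sup>2 + y t)" for t
    using inverse_sqrt_enclosure(1)[OF D y, of t t] by (simp add: y_def)
  ultimately have "pi / (2 * a) - (1 - a\<^sup>2)\<^sup>2 / 2 * (pi / (16 * a ^ 3)) \<le> ellipK r"
    using has_integral_le K by blast
  then show "pi / (2 * a) * (1 - (1 - a\<^sup>2)\<^sup>2 / (16 * a\<^sup>2)) \<le> ellipK r"
    using \<open>a > 0\<close> by (simp add: field_simps power2_eq_square power3_eq_cube)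
qed

theorem theorem3p2:
  fixes r :: real
  assumes "0 < r" and "r < 1"
  shows "pi * sqrt (32 - r ^ 4 - 32 * r\<^sup>2) / (8 * sqrt 2 * root 4 ((1 - r\<^sup>2) ^ 3)) \<le> ellipK r \<and>
         ellipK r \<le> pi * sqrt (r ^ 4 - 32 * r\<^sup>2 + 32) / (8 * sqrt 2 * root 4 ((1 - r\<^sup>2) ^ 3))"
proof -
  define a where "a = root 4 (1 - r\<^sup>2)"
  have q: "1 - r\<^sup>2 > 0" using assms by (simp add: power_less_one_iff)
  have a: "a > 0" and a4: "a ^ 4 = 1 - r\<^sup>2" using q by (simp_all add: a_def)
  note K = ellipK_enclosure[OF a a4]
  \<comment> \<open>This is \<open>\<delta>\<close> of the overview, since
    \<open>r\<^sup>2 = 1 - s\<^sup>2\<close>.\<close>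
  define d where "d = r ^ 4 / (32 * a ^ 4)"
  have r4: "r ^ 4 = (1 - a ^ 4)\<^sup>2" using a4 by algebra
  have d0: "d \<ge> 0" using a by (simp add: d_def)
  have norm: "pi * sqrt (32 * a ^ 4 * z) / (8 * sqrt 2 * root 4 ((1 - r\<^sup>2) ^ 3)) = pi / (2 * a) * sqrt z" for z
  proof -
    have "root 4 ((1 - r\<^sup>2) ^ 3) = a ^ 3"
      using q by (simp add: a_def real_root_power)
    moreover have "sqrt (32 * a ^ 4) = 4 * sqrt 2 * a\<^sup>2"
      using a by (intro real_sqrt_unique) (simp_all add: power_mult_distrib flip: power_mult)
    then have "sqrt (32 * a ^ 4 * z) = 4 * sqrt 2 * a\<^sup>2 * sqrt z"
      unfolding real_sqrt_mult[of "32 * a ^ 4"] by simp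
    ultimately have "pi * sqrt (32 * a ^ 4 * z) / (8 * sqrt 2 * root 4 ((1 - r\<^sup>2) ^ 3))
        = pi * (4 * sqrt 2 * a\<^sup>2 * sqrt z) / (8 * sqrt 2 * a ^ 3)"
      by (simp only:)
    also have "\<dots> = pi / (2 * a) * sqrt z"
      using a by (simp add: field_simps power2_eq_square power3_eq_cube)
    finally show ?thesis .
  qed
  have rd: "32 * a ^ 4 * d = r ^ 4" using a by (simp add: d_def)
  have lo: "32 - r ^ 4 - 32 * r\<^sup>2 = 32 * a ^ 4 * (1 - d)"
    and up: "r ^ 4 - 32 * r\<^sup>2 + 32 = 32 * a ^ 4 * (1 + d)"
    using rd a4 by algebra+
  have "pi / (2 * a) * sqrt (1 - d) \<le> ellipK r"
  proof (cases "d \<le> 1")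
    case True
    \<comment> \<open>AM-GM for \<open>1\<close> and \<open>s\<close>; it yields
      \<open>(1 - s)\<^sup>2 / (16 * s) \<le> d / 2\<close>.\<close>
    have "4 * a\<^sup>2 \<le> (1 + a\<^sup>2)\<^sup>2"
      using zero_le_power2[of "1 - a\<^sup>2"] by (simp add: power2_eq_square algebra_simps)
    then have "(1 - a\<^sup>2)\<^sup>2 * (4 * a\<^sup>2) \<le> (1 - a\<^sup>2)\<^sup>2 * (1 + a\<^sup>2)\<^sup>2"
      by (rule mult_left_mono) simp
    also have "\<dots> = r ^ 4" unfolding r4 by algebra
    finally have "(1 - a\<^sup>2)\<^sup>2 * (4 * a\<^sup>2) / (64 * a ^ 4) \<le> r ^ 4 / (64 * a ^ 4)"
      by (rule divide_right_mono) simp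
    moreover have "(1 - a\<^sup>2)\<^sup>2 * (4 * a\<^sup>2) / (64 * a ^ 4) = (1 - a\<^sup>2)\<^sup>2 / (16 * a\<^sup>2)"
      using a by (simp add: divide_simps)
    ultimately have "(1 - a\<^sup>2)\<^sup>2 / (16 * a\<^sup>2) \<le> d / 2"
      by (simp add: d_def)
    moreover have "sqrt (1 - d) \<le> 1 - d / 2"
      using True by (intro real_le_lsqrt) (simp_all add: power2_eq_square algebra_simps)
    ultimately have "pi / (2 * a) * sqrt (1 - d) \<le> pi / (2 * a) * (1 - (1 - a\<^sup>2)\<^sup>2 / (16 * a\<^sup>2))"
      using a by (intro mult_left_mono) simp_all
    with K(1) show ?thesis by simp
  next
    case False
    \<comment> \<open>For \<open>d > 1\<close> the real \<open>sqrt\<close>, being odd, takes a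
      negative value.\<close>
    then have "pi / (2 * a) * sqrt (1 - d) \<le> 0"
      using a by (intro mult_nonneg_nonpos) simp_all
    also have "0 \<le> ellipK r" by (rule K(3))
    finally show ?thesis .
  qed
  moreover have "ellipK r \<le> pi / (2 * a) * sqrt (1 + d)"
  proof -
    have "pi / (2 * a) * 1 \<le> pi / (2 * a) * sqrt (1 + d)"
      using a d0 by (intro mult_left_mono) simp_all
    with K(2) show ?thesis by simp
  qed
  ultimately show ?thesis unfolding lo up norm by blast
qed

end
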